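(* Let $n\ge1$, $V=\{1,\dots,n\}$, and let $\mathbf a,\mathbf b\in\mathbb R^n$ have positive entries with $a_1\le\cdots\le a_n$ and $b_1\ge\cdots\ge b_n$. Then a vector $\mathbf y\in\mathbb R^n_+$ lies in $\Delta(\mathbf a)+\Delta(\mathbf b)$ if and only if it satisfies $$a_m\sum_{i=1}^m\frac{y_i}{a_i}+b_m\sum_{i=m+1}^n\frac{y_i}{b_i}\ \ge\ a_m+b_m\quad\text{for all } m\in V,$$ and $$b_m\sum_{i=1}^m\frac{y_i}{b_i}+a_m\sum_{i=m+1}^n\frac{y_i}{a_i}\ \le\ a_m+b_m\quad\text{for all } m\in V.$$
   Context: For a vector $\mathbf w\in\mathbb R^n_+$, $\Delta(\mathbf w)=\{\sum_{i=1}^n\theta_iw_i\mathbf e^i:\ \theta_i\ge0,\ \sum_{i=1}^n\theta_i=1\}$, where $\mathbf e^i$ is the $i$-th standard unit vector. $\Delta(\mathbf a)+\Delta(\mathbf b)$ denotes the Minkowski sum; it is the mixed strategy set of Player 2 in the zero-sum game considered in the paper. Here $\mathbb R^n_+$ is the set of vectors with nonnegative entries. *)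

theory Defs
  imports "HOL-Analysis.Analysis" "HOL-Library.Set_Algebras"
begin

text \<open>
  Vectors live in \<open>real ^ 'n\<close>. Where the order of the coordinates matters, the index set
  $\{1,\dots,n\}$ with its usual order is the universe of a type \<open>'n :: {finite, linorder}\<close>,
  where $n$ is \<open>CARD('n)\<close> (automatically at least 1). So $i = 1,\dots,m$ is \<open>i \<in> {..m}\<close>
  and $i = m+1,\dots,n$ is \<open>i \<in> {m<..}\<close>, which is empty if \<open>m\<close> is the greatest index.
  The operation \<open>+\<close> on sets of vectors is the Minkowski sum, by \<open>set_plus_def\<close>.
\<close>

definition nonneg_orthant :: "(real ^ 'n) set" where
  "nonneg_orthant = {x. \<forall>i. 0 \<le> x $ i}"

definition Delta :: "real ^ 'n \<Rightarrow> (real ^ 'n) set" where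
  "Delta w = {(\<Sum>i\<in>UNIV. (\<theta> i * w $ i) *\<^sub>R axis i 1) | \<theta> :: 'n \<Rightarrow> real.
                (\<forall>i. 0 \<le> \<theta> i) \<and> (\<Sum>i\<in>UNIV. \<theta> i) = 1}"

end

theory Submission
  imports Defs
begin

text \<open>
  Splitting each $y_i$ into a share $u_i$ assigned to $\mathbf a$ and a share $1-u_i$ assigned to
  $\mathbf b$, membership means that some $u \in [0,1]^n$ has $p(u) = \sum u_i y_i/a_i = 1$ and
  $q(u) = \sum (1-u_i) y_i/b_i = 1$. Both families of inequalities bound $a_m p + b_m q$
  termwise over such $u$, which gives necessity. Conversely, the inequality for $m = n$ gives
  $\sum y_i/a_i \ge 1$, so one can reach $p = 1$ by a share that is $1$ before some index $m$ and $0$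
  after it, and also by one that is $0$ before some index and $1$ after it. The two inequalities at
  these indices say precisely that the first has $q \ge 1$ and the second $q \le 1$; a convex
  combination of them has $p = q = 1$.
\<close>

lemma mem_Delta_iff:
  "x \<in> Delta w \<longleftrightarrow>
    (\<exists>\<theta>. (\<forall>i. 0 \<le> \<theta> i) \<and> (\<Sum>i\<in>UNIV. \<theta> i) = 1 \<and> (\<forall>i. x $ i = \<theta> i * w $ i))"
proof -
  have "(\<Sum>i\<in>UNIV. (\<theta> i * w $ i) *\<^sub>R axis i 1) = (\<chi> i. \<theta> i * w $ i)" for \<theta>
    by (simp add: vec_eq_iff axis_def if_distrib cong: if_cong)
  then show ?thesis
    by (auto simp: Delta_def vec_eq_iff)
qed

lemma mem_Delta_plus_Delta_iff:
  "y \<in> Delta a + Delta b \<longleftrightarrow>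
    (\<exists>\<theta> \<phi>. (\<forall>i. 0 \<le> \<theta> i) \<and> (\<Sum>i\<in>UNIV. \<theta> i) = 1 \<and>
           (\<forall>i. 0 \<le> \<phi> i) \<and> (\<Sum>i\<in>UNIV. \<phi> i) = 1 \<and>
           (\<forall>i. y $ i = \<theta> i * a $ i + \<phi> i * b $ i))"
  (is "_ \<longleftrightarrow> ?R")
proof
  assume "y \<in> Delta a + Delta b"
  then obtain p q where "p \<in> Delta a" "q \<in> Delta b" "y = p + q"
    by (rule set_plus_elim)
  then show ?R
    unfolding mem_Delta_iff by (metis vector_add_component)
next
  assume ?R
  then obtain \<theta> \<phi> where *: "\<forall>i. 0 \<le> \<theta> i" "(\<Sum>i\<in>UNIV. \<theta> i) = 1"
    "\<forall>i. 0 \<le> \<phi> i" "(\<Sum>i\<in>UNIV. \<phi> i) = 1" "\<forall>i. y $ i = \<theta> i * a $ i + \<phi> i * b $ i"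
    by blast
  have "(\<chi> i. \<theta> i * a $ i) \<in> Delta a" "(\<chi> i. \<phi> i * b $ i) \<in> Delta b"
    using * by (auto simp: mem_Delta_iff)
  moreover have "y = (\<chi> i. \<theta> i * a $ i) + (\<chi> i. \<phi> i * b $ i)"
    using * by (simp add: vec_eq_iff)
  ultimately show "y \<in> Delta a + Delta b"
    by (auto simp: set_plus_def)
qed

text \<open>Puts a sum split at \<open>m\<close> under a single sum over all indices, so that it can
  be compared term by term.\<close>

lemma sum_UNIV_split_le:
  fixes f g :: "'n::{finite, linorder} \<Rightarrow> 'a::comm_monoid_add"
  shows "sum f {..m} + sum g {m<..} = (\<Sum>i\<in>UNIV. if i \<le> m then f i else g i)"
proof -
  have "UNIV \<inter> {i. i \<le> m} = {..m}" "UNIV \<inter> - {i. i \<le> m} = {m<..}"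
    by auto
  then show ?thesis
    by (simp add: sum.If_cases)
qed

text \<open>Greedy filling: \<open>m\<close> is the least index at which the partial sums of
  \<open>w\<close> reach \<open>s\<close>, and \<open>u m\<close> is the fraction of
  \<open>w m\<close> still missing there.\<close>

lemma exists_threshold:
  fixes w :: "'n::{finite, linorder} \<Rightarrow> real"
  assumes "\<And>i. 0 \<le> w i" "0 \<le> s" "s \<le> sum w UNIV"
  obtains u m where "\<And>i. 0 \<le> u i \<and> u i \<le> 1" "\<And>i. i < m \<Longrightarrow> u i = 1" "\<And>i. m < i \<Longrightarrow> u i = 0"
    "(\<Sum>i\<in>UNIV. u i * w i) = s"
proof -
  define S where "S = {m. s \<le> sum w {..m}}"
  define m where "m = Min S"
  have "{..Max UNIV :: 'n} = UNIV"
    by auto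
  then have "S \<noteq> {}"
    using assms(3) unfolding S_def by (metis empty_iff mem_Collect_eq)
  then have "m \<in> S"
    unfolding m_def by (intro Min_in) auto
  then have ge: "s \<le> sum w {..m}"
    by (simp add: S_def)
  have le: "sum w {..<m} \<le> s"
  proof (cases "{..<m} = {}")
    case True
    then show ?thesis using assms(2) by (metis sum.empty)
  next
    case False
    \<comment> \<open>\<open>k\<close> is the predecessor of \<open>m\<close>; by minimality of
      \<open>m\<close> its partial sum is still below \<open>s\<close>.\<close>
    define k where "k = Max {..<m}"
    have "k \<in> {..<m}"
      unfolding k_def using False by (intro Max_in) auto
    then have "{..k} = {..<m}"
      unfolding k_def by (auto simp: Max_ge_iff)
    moreover have "k \<notin> S"
      using \<open>k \<in> {..<m}\<close> Min_le[OF finite, of k S] unfolding m_def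
      by (metis lessThan_iff not_less)
    ultimately show ?thesis
      by (auto simp: S_def)
  qed
  have atMost_eq: "{..m} = insert m {..<m}"
    by auto
  have "sum w {..m} = sum w {..<m} + w m"
    using atMost_eq sum.insert[of "{..<m}" m w] by (simp add: add.commute)
  then have "s - sum w {..<m} \<le> w m"
    using ge by simp
  \<comment> \<open>If \<open>w m = 0\<close>, division yields \<open>c = 0\<close>, which still
    fits: the two bounds then force \<open>s = sum w {..<m}\<close>.\<close>
  define c where "c = (s - sum w {..<m}) / w m"
  have c: "0 \<le> c" "c \<le> 1" "sum w {..<m} + c * w m = s"
    using le \<open>s - sum w {..<m} \<le> w m\<close> assms(1)[of m]
    by (auto simp: c_def divide_simps)
  define u where "u = (\<lambda>i. if i < m then 1 else if i = m then c else 0)"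
  have "(\<Sum>i\<in>UNIV. u i * w i) = (\<Sum>i\<in>{..m}. u i * w i)"
    by (rule sum.mono_neutral_right) (auto simp: u_def)
  also have "\<dots> = (\<Sum>i\<in>{..<m}. u i * w i) + u m * w m"
    using atMost_eq sum.insert[of "{..<m}" m "\<lambda>i. u i * w i"] by (simp add: add.commute)
  also have "\<dots> = s"
    using c(3) by (simp add: u_def)
  finally have "(\<Sum>i\<in>UNIV. u i * w i) = s" .
  with c show ?thesis
    by (intro that[of u m]) (auto simp: u_def)
qed

text \<open>Index \<open>m\<close> contributes \<open>u m * f m + (1 - u m) * g m\<close>, which is
  \<open>f m\<close> whatever the fraction \<open>u m\<close>, because
  \<open>f m = g m\<close>.\<close>

lemma sum_threshold:
  fixes f g u :: "'n::{finite, linorder} \<Rightarrow> real"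
  assumes "\<And>i. i < m \<Longrightarrow> u i = 1" "\<And>i. m < i \<Longrightarrow> u i = 0" "f m = g m"
  shows "(\<Sum>i\<in>UNIV. u i * f i) + (\<Sum>i\<in>UNIV. (1 - u i) * g i) = sum f {..m} + sum g {m<..}"
proof -
  have "u i * f i + (1 - u i) * g i = (if i \<le> m then f i else g i)" for i
    using assms by (cases i m rule: linorder_cases) (auto simp: algebra_simps)
  then show ?thesis
    by (simp add: sum_UNIV_split_le flip: sum.distrib)
qed

theorem lemma3:
  fixes a b y :: "real ^ 'n::{finite, linorder}"
  assumes "\<And>i. 0 < a $ i" and "\<And>i. 0 < b $ i"
    and "\<And>i j. i \<le> j \<Longrightarrow> a $ i \<le> a $ j"
    and "\<And>i j. i \<le> j \<Longrightarrow> b $ j \<le> b $ i"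
    and "y \<in> nonneg_orthant"
  shows "y \<in> Delta a + Delta b \<longleftrightarrow>
    (\<forall>m. a $ m * (\<Sum>i\<in>{..m}. y $ i / a $ i) + b $ m * (\<Sum>i\<in>{m<..}. y $ i / b $ i)
            \<ge> a $ m + b $ m) \<and>
    (\<forall>m. b $ m * (\<Sum>i\<in>{..m}. y $ i / b $ i) + a $ m * (\<Sum>i\<in>{m<..}. y $ i / a $ i)
            \<le> a $ m + b $ m)"
    (is "_ \<longleftrightarrow> ?lower \<and> ?upper")
proof
  assume "y \<in> Delta a + Delta b"
  then obtain \<theta> \<phi> where \<theta>: "\<And>i. 0 \<le> \<theta> i" "(\<Sum>i\<in>UNIV. \<theta> i) = 1"
    and \<phi>: "\<And>i. 0 \<le> \<phi> i" "(\<Sum>i\<in>UNIV. \<phi> i) = 1"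
    and y: "\<And>i. y $ i = \<theta> i * a $ i + \<phi> i * b $ i"
    unfolding mem_Delta_plus_Delta_iff by blast
  have total: "a $ m + b $ m = (\<Sum>i\<in>UNIV. \<theta> i * a $ m + \<phi> i * b $ m)" for m
    using \<theta>(2) \<phi>(2) by (simp add: sum.distrib flip: sum_distrib_right)
  have y_a: "a $ m * (y $ i / a $ i) = \<theta> i * a $ m + \<phi> i * (a $ m * b $ i / a $ i)" for m i
    using assms(1)[of i] by (simp add: y field_simps)
  have y_b: "b $ m * (y $ i / b $ i) = \<phi> i * b $ m + \<theta> i * (b $ m * a $ i / b $ i)" for m i
    using assms(2)[of i] by (simp add: y field_simps)
  \<comment> \<open>The ratio of \<open>a $ i\<close> to \<open>b $ i\<close> is nondecreasing in
    \<open>i\<close>; these bounds and the next two are cleared-denominator forms of this.\<close>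
  have low_a: "b $ m \<le> a $ m * b $ i / a $ i" and low_b: "b $ m * a $ i / b $ i \<le> a $ m"
    if "i \<le> m" for m i
  proof -
    have "b $ m * a $ i \<le> b $ i * a $ m"
      using that assms(1,2)[of i] by (intro mult_mono assms) (auto intro: less_imp_le)
    then show "b $ m \<le> a $ m * b $ i / a $ i" "b $ m * a $ i / b $ i \<le> a $ m"
      using assms(1,2)[of i] by (simp_all add: field_simps)
  qed
  have high_a: "a $ m * b $ i / a $ i \<le> b $ m" and high_b: "a $ m \<le> b $ m * a $ i / b $ i"
    if "m \<le> i" for m i
  proof -
    have "b $ i * a $ m \<le> b $ m * a $ i"
      using that assms(1,2)[of m] by (intro mult_mono assms) (auto intro: less_imp_le)
    then show "a $ m * b $ i / a $ i \<le> b $ m" "a $ m \<le> b $ m * a $ i / b $ i"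
      using assms(1,2)[of i] by (simp_all add: field_simps)
  qed
  \<comment> \<open>Summand by summand, \<open>low_a\<close> and \<open>high_b\<close> give the
    lower bound, \<open>low_b\<close> and \<open>high_a\<close> the upper one.\<close>
  show "?lower \<and> ?upper"
    unfolding total sum_distrib_left sum_UNIV_split_le y_a y_b
    using low_a[THEN mult_left_mono, OF _ \<phi>(1)] low_b[THEN mult_left_mono, OF _ \<theta>(1)]
      high_a[THEN mult_left_mono, OF _ \<phi>(1)] high_b[THEN mult_left_mono, OF _ \<theta>(1)]
    by (auto intro!: sum_mono)
next
  assume bounds: "?lower \<and> ?upper"
  define A where "A = (\<lambda>i. y $ i / a $ i)"
  define B where "B = (\<lambda>i. y $ i / b $ i)"
  have nonneg: "0 \<le> A i" "0 \<le> B i" for i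
    using assms(1,2)[of i] assms(5) by (auto simp: A_def B_def nonneg_orthant_def)
  \<comment> \<open>Both sides equal \<open>y $ m\<close>; this is the agreement at \<open>m\<close>
    that \<open>sum_threshold\<close> asks for.\<close>
  have AB: "a $ m * A m = b $ m * B m" for m
    using assms(1,2)[of m] by (simp add: A_def B_def)
  have lower: "a $ m + b $ m \<le> (\<Sum>i\<in>{..m}. a $ m * A i) + (\<Sum>i\<in>{m<..}. b $ m * B i)"
    and upper: "(\<Sum>i\<in>{..m}. b $ m * B i) + (\<Sum>i\<in>{m<..}. a $ m * A i) \<le> a $ m + b $ m" for m
    using bounds by (simp_all add: A_def B_def sum_distrib_left)
  have sum_A: "1 \<le> sum A UNIV"
  proof -
    define n where "n = Max (UNIV :: 'n set)"
    have "{..n} = UNIV" "{n<..} = {}"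
      by (auto simp: n_def not_less)
    then have "a $ n * 1 \<le> a $ n * sum A UNIV"
      using lower[of n] assms(2)[of n] by (simp add: sum_distrib_left)
    then show ?thesis
      using assms(1)[of n] by simp
  qed
  obtain u where u: "\<And>i. 0 \<le> u i \<and> u i \<le> 1" "(\<Sum>i\<in>UNIV. u i * A i) = 1"
    "1 \<le> (\<Sum>i\<in>UNIV. (1 - u i) * B i)"
  proof -
    obtain u m where u: "\<And>i. 0 \<le> u i \<and> u i \<le> 1" "\<And>i. i < m \<Longrightarrow> u i = 1"
      "\<And>i. m < i \<Longrightarrow> u i = 0" "(\<Sum>i\<in>UNIV. u i * A i) = 1"
      using exists_threshold[of A 1] nonneg(1) sum_A by (metis zero_le_one)
    \<comment> \<open>At the threshold index the right side is exactly the left side of the lower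
      inequality. As the \<open>A\<close>-sum is 1, \<open>a $ m\<close> cancels.\<close>
    have "a $ m + b $ m \<le> a $ m * (\<Sum>i\<in>UNIV. u i * A i) + b $ m * (\<Sum>i\<in>UNIV. (1 - u i) * B i)"
      using sum_threshold[of m u "\<lambda>i. a $ m * A i" "\<lambda>i. b $ m * B i", OF u(2,3) AB]
        lower[of m]
      by (simp add: sum_distrib_left mult.left_commute)
    then have "b $ m * 1 \<le> b $ m * (\<Sum>i\<in>UNIV. (1 - u i) * B i)"
      by (simp add: u(4))
    then show ?thesis
      using that[of u] u assms(2)[of m] by simp
  qed
  obtain v where v: "\<And>i. 0 \<le> v i \<and> v i \<le> 1" "(\<Sum>i\<in>UNIV. v i * A i) = 1"
    "(\<Sum>i\<in>UNIV. (1 - v i) * B i) \<le> 1"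
  proof -
    \<comment> \<open>Here \<open>u\<close> is the complement of the wanted share: it takes the
      excess \<open>sum A UNIV - 1\<close> from the first indices, so \<open>1 - u\<close> keeps
      \<open>A\<close>-sum 1 on the last ones.\<close>
    obtain u m where u: "\<And>i. 0 \<le> u i \<and> u i \<le> 1" "\<And>i. i < m \<Longrightarrow> u i = 1"
      "\<And>i. m < i \<Longrightarrow> u i = 0" "(\<Sum>i\<in>UNIV. u i * A i) = sum A UNIV - 1"
      by (rule exists_threshold[of A "sum A UNIV - 1"]) (use nonneg(1) sum_A in auto)
    have 1: "(\<Sum>i\<in>UNIV. (1 - u i) * A i) = 1"
      using u(4) by (simp add: left_diff_distrib sum_subtractf)
    have "b $ m * (\<Sum>i\<in>UNIV. u i * B i) + a $ m * (\<Sum>i\<in>UNIV. (1 - u i) * A i) \<le> a $ m + b $ m"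
      using sum_threshold[of m u "\<lambda>i. b $ m * B i" "\<lambda>i. a $ m * A i", OF u(2,3) AB[symmetric]]
        upper[of m]
      by (simp add: sum_distrib_left mult.left_commute)
    then have "b $ m * (\<Sum>i\<in>UNIV. u i * B i) \<le> b $ m * 1"
      by (simp add: 1)
    then show ?thesis
      using that[of "\<lambda>i. 1 - u i"] u(1) 1 assms(2)[of m] by simp
  qed
  have "1 \<in> closed_segment (\<Sum>i\<in>UNIV. (1 - v i) * B i) (\<Sum>i\<in>UNIV. (1 - u i) * B i)"
    using u(3) v(3) by (simp add: closed_segment_eq_real_ivl)
  then obtain t where t: "0 \<le> t" "t \<le> 1"
    "1 = (1 - t) * (\<Sum>i\<in>UNIV. (1 - v i) * B i) + t * (\<Sum>i\<in>UNIV. (1 - u i) * B i)"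
    by (auto simp: in_segment)
  \<comment> \<open>Both sums are affine in the share, so mixing keeps the \<open>A\<close>-sum at
    1, while \<open>t\<close> brings the \<open>B\<close>-sum to 1.\<close>
  define x where "x = (\<lambda>i. (1 - t) * v i + t * u i)"
  have x: "0 \<le> x i" "x i \<le> 1" for i
    using u(1)[of i] v(1)[of i] t(1,2) convex_bound_le[of "v i" 1 "u i" "1 - t" t]
    by (simp_all add: x_def)
  have "(\<Sum>i\<in>UNIV. x i * A i) = (1 - t) * (\<Sum>i\<in>UNIV. v i * A i) + t * (\<Sum>i\<in>UNIV. u i * A i)"
    unfolding sum_distrib_left sum.distrib[symmetric]
    by (intro sum.cong) (simp_all add: x_def algebra_simps)
  then have xA: "(\<Sum>i\<in>UNIV. x i * A i) = 1"
    by (simp add: u(2) v(2))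
  have "(\<Sum>i\<in>UNIV. (1 - x i) * B i) =
      (1 - t) * (\<Sum>i\<in>UNIV. (1 - v i) * B i) + t * (\<Sum>i\<in>UNIV. (1 - u i) * B i)"
    unfolding sum_distrib_left sum.distrib[symmetric]
    by (intro sum.cong) (simp_all add: x_def algebra_simps)
  also have "\<dots> = 1"
    by (rule t(3)[symmetric])
  finally have xB: "(\<Sum>i\<in>UNIV. (1 - x i) * B i) = 1" .
  have "y $ i = x i * A i * a $ i + (1 - x i) * B i * b $ i" for i
  proof -
    have "A i * a $ i = y $ i" "B i * b $ i = y $ i"
      using assms(1,2)[of i] by (simp_all add: A_def B_def)
    then show ?thesis
      by (simp add: mult.assoc left_diff_distrib)
  qed
  \<comment> \<open>The part \<open>x i * y $ i\<close> of each coordinate goes to \<open>a\<close>,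
    the rest to \<open>b\<close>; dividing by \<open>a $ i\<close> and \<open>b $ i\<close> gives
    the weights.\<close>
  with x nonneg xA xB show "y \<in> Delta a + Delta b"
    unfolding mem_Delta_plus_Delta_iff
    by (intro exI[of _ "\<lambda>i. x i * A i"] exI[of _ "\<lambda>i. (1 - x i) * B i"]) simp
qed

end
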